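(* Let $(d_n)_{n\ge 1}$ be an arbitrary sequence of complex numbers, and let $(a_n)_{n\ge 0}$ be defined by $a_0=1$, $a_1=1$ and $a_{n+1}=a_n+d_n\, a_{n-1}$ for all integers $n\ge 1$. Then for every integer $n\ge 1$, $$a_{n+1}=1+\sum_{p=1}^{\lfloor (n+1)/2\rfloor} S(n,p),$$ where $S(n,p)=\tilde{\mathbf R}(n-2p,p)$ and $\tilde{\mathbf R}$ is the reduced R-sum of the sequence $(d_i)$.
   Context: $\lfloor x\rfloor$ is the floor function. For integers $k\ge 1$ and $N\ge -1$, the reduced R-sum of the sequence $(d_i)_{i\ge1}$ is the nested sum $$\tilde{\mathbf R}(N,k)=\sum_{i_1=1}^{N+2} d_{i_1}\sum_{i_2=i_1+2}^{N+4} d_{i_2}\cdots\sum_{i_{k-1}=i_{k-2}+2}^{N+2(k-1)} d_{i_{k-1}}\sum_{i_k=i_{k-1}+2}^{N+2k} d_{i_k},$$ i.e. the sum of $d_{i_1}d_{i_2}\cdots d_{i_k}$ over all integer tuples $(i_1,\dots,i_k)$ with $1\le i_1\le N+2$ and $i_{m-1}+2\le i_m\le N+2m$ for $2\le m\le k$. Hence $S(n,p)$ is defined for $n\geq 1$ and $1\le p\le \lfloor (n+1)/2\rfloor$. *)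

theory Defs
  imports Complex_Main
begin

(* The tail of the nested sum that starts at level m:
     SUM i_m = lo .. N+2m.  d(i_m) * (SUM i_(m+1) = i_m + 2 .. N+2(m+1).  d(i_(m+1)) * ...),
   with r summation signs remaining. For N >= -1 and m >= 1 the upper limit N + 2m is
   at least 1, so the conversion to nat does not truncate. *)
fun nested_sum :: "(nat \<Rightarrow> complex) \<Rightarrow> int \<Rightarrow> nat \<Rightarrow> nat \<Rightarrow> nat \<Rightarrow> complex" where
  "nested_sum d N m 0 lo = 1"
| "nested_sum d N m (Suc r) lo =
     (\<Sum>i = lo..nat (N + 2 * int m). d i * nested_sum d N (Suc m) r (i + 2))"

(* Intended for k >= 1 and N >= -1. The value d 0 is never used. *)
definition reduced_R_sum :: "(nat \<Rightarrow> complex) \<Rightarrow> int \<Rightarrow> nat \<Rightarrow> complex" where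
  "reduced_R_sum d N k = nested_sum d N 1 k 1"

lemma reduced_R_sum_3:
  "reduced_R_sum d N 3 =
     (\<Sum>i1 = 1..nat (N + 2). d i1 *
       (\<Sum>i2 = i1 + 2..nat (N + 4). d i2 *
         (\<Sum>i3 = i2 + 2..nat (N + 6). d i3)))"
  by (simp add: reduced_R_sum_def numeral_3_eq_3)

(* n - 2p is an integer that may be -1, hence the subtraction in int.
   Intended for 1 <= p <= (n + 1) div 2, which gives n - 2p >= -1. *)
definition S :: "(nat \<Rightarrow> complex) \<Rightarrow> nat \<Rightarrow> nat \<Rightarrow> complex" where
  "S d n p = reduced_R_sum d (int n - 2 * int p) p"

end

theory Submission
  imports Defs
begin

text \<open>
  \<open>S n p\<close> runs over the \<open>p\<close>-subsets of \<open>{1..n}\<close> without two consecutive elements. Splitting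
  according to whether \<open>n + 1\<close> occurs gives \<open>S (n+1) (p+1) = S n (p+1) + d (n+1) * S (n-1) p\<close>;
  summed over \<open>p\<close>, this is the recurrence of \<open>a\<close>. Since the nested sum peels off the smallest
  element, the splitting is proved by induction on \<open>p\<close> for an arbitrary lower bound.
\<close>

definition S_from :: "(nat \<Rightarrow> complex) \<Rightarrow> nat \<Rightarrow> nat \<Rightarrow> nat \<Rightarrow> complex" where
  "S_from d lo n p = nested_sum d (int n - 2 * int p) 1 p lo"

lemma S_eq_S_from: "S d n p = S_from d 1 n p"
  by (simp add: S_def reduced_R_sum_def S_from_def)

text \<open>The level enters only through \<open>N + 2 * m\<close>, so a step in it can be absorbed
  into \<open>N\<close>. This lets \<open>S_from\<close> keep \<open>n\<close> fixed when the
  smallest index is peeled off.\<close>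

lemma nested_sum_Suc_level: "nested_sum d N (Suc m) r lo = nested_sum d (N + 2) m r lo"
  by (induction r arbitrary: m lo) (simp_all add: algebra_simps)

lemma S_from_0 [simp]: "S_from d lo n 0 = 1"
  by (simp add: S_from_def)

lemma S_from_Suc: "S_from d lo n (Suc r) = (\<Sum>i = lo..n - 2 * r. d i * S_from d (i + 2) n r)"
proof -
  have level: "nested_sum d (int n - 2 * int (Suc r)) (Suc 1) r l = S_from d l n r" for l
    unfolding nested_sum_Suc_level S_from_def by simp
  have bound: "nat (int n - 2 * int (Suc r) + 2 * int 1) = n - 2 * r"
    by simp
  show ?thesis
    unfolding S_from_def [of d lo] nested_sum.simps level bound ..
qed

lemma S_from_eq_0: "n - 2 * r < lo \<Longrightarrow> S_from d lo n (Suc r) = 0"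
  by (simp add: S_from_Suc)

text \<open>At \<open>n = 0\<close> the truncated \<open>n - 1 = 0\<close> does no harm: both sides vanish unless \<open>r = 0\<close>,
  and then \<open>S_from d lo (n - 1) r\<close> is \<open>1\<close> anyway.\<close>

lemma S_from_Suc_Suc:
  assumes "1 \<le> lo" "lo \<le> n + 1"
  shows "S_from d lo (Suc n) (Suc r) = S_from d lo n (Suc r) + d (Suc n) * S_from d lo (n - 1) r"
  using assms
proof (induction r arbitrary: lo)
  case 0
  then show ?case
    by (simp add: S_from_Suc)
next
  case (Suc r)
  \<comment> \<open>\<open>u\<close> bounds the first index both on the left and in
    \<open>S_from d lo (n - 1) (Suc r)\<close>.\<close>
  define u where "u = n - 1 - 2 * r"
  have "S_from d lo (Suc n) (Suc (Suc r)) = (\<Sum>i = lo..u. d i * S_from d (i + 2) (Suc n) (Suc r))"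
    by (subst S_from_Suc) (simp add: u_def)
  also have "\<dots> = (\<Sum>i = lo..u. d i * S_from d (i + 2) n (Suc r)
      + d (Suc n) * (d i * S_from d (i + 2) (n - 1) r))"
  proof (rule sum.cong)
    fix i assume "i \<in> {lo..u}"
    then have "i + 2 \<le> n + 1"
      using Suc.prems by (auto simp: u_def)
    then show "d i * S_from d (i + 2) (Suc n) (Suc r) = d i * S_from d (i + 2) n (Suc r)
        + d (Suc n) * (d i * S_from d (i + 2) (n - 1) r)"
      by (subst Suc.IH) (simp_all add: algebra_simps)
  qed simp
  also have "\<dots> = (\<Sum>i = lo..u. d i * S_from d (i + 2) n (Suc r))
      + d (Suc n) * S_from d lo (n - 1) (Suc r)"
    by (simp add: sum.distrib sum_distrib_left S_from_Suc u_def)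
  \<comment> \<open>At most the term \<open>i = u\<close> is lost; it vanishes, since
    \<open>u + 2\<close> exceeds \<open>n - 2 * r\<close>. If \<open>u = 0\<close>, then
    \<open>1 \<le> lo\<close> makes both ranges empty.\<close>
  also have "(\<Sum>i = lo..u. d i * S_from d (i + 2) n (Suc r))
      = (\<Sum>i = lo..n - 2 * Suc r. d i * S_from d (i + 2) n (Suc r))"
    using Suc.prems by (intro sum.mono_neutral_right) (auto simp: u_def S_from_eq_0)
  also have "\<dots> = S_from d lo n (Suc (Suc r))"
    by (rule S_from_Suc [symmetric])
  finally show ?case .
qed

text \<open>Leaving \<open>K\<close> free lets the induction use limit \<open>K\<close> for
  \<open>a (m + 1)\<close> and \<open>K - 1\<close> for \<open>a m\<close>, so shifting
  \<open>p\<close> by one leaves no boundary terms. The truncated \<open>n - 1\<close> treats both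
  initial values alike.\<close>

lemma recurrence_eq_sum_S_from:
  fixes d a :: "nat \<Rightarrow> complex"
  assumes a0: "a 0 = 1" and a1: "a 1 = 1"
    and rec: "\<And>m. m \<ge> 1 \<Longrightarrow> a (m + 1) = a m + d m * a (m - 1)"
    and "n \<le> K + 1"
  shows "a n = (\<Sum>p\<le>K. S_from d 1 (n - 1) p)"
  using \<open>n \<le> K + 1\<close>
proof (induction n arbitrary: K rule: less_induct)
  case (less n)
  consider "n \<le> 1" | m where "n = m + 2"
    by (metis add.commute le_Suc_ex nat_le_linear not_less_eq_eq numeral_2_eq_2 One_nat_def)
  then show ?case
  proof cases
    case 1
    then have "n - 1 = 0" "a n = 1"
      using a0 a1 by (auto simp: le_Suc_eq)
    then show ?thesis
      by (simp add: sum.atMost_shift S_from_eq_0)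
  next
    case 2
    then obtain L where K: "K = Suc L" and L: "m \<le> L"
      using less.prems by (cases K) auto
    have "a n = a (m + 1) + d (m + 1) * a m"
      using rec [of "m + 1"] 2 by simp
    also have "a (m + 1) = (\<Sum>p\<le>K. S_from d 1 m p)"
      using less.IH [of "m + 1" K] 2 K L by simp
    also have "a m = (\<Sum>p\<le>L. S_from d 1 (m - 1) p)"
      using less.IH [of m L] 2 L by simp
    also have "(\<Sum>p\<le>K. S_from d 1 m p) + d (m + 1) * (\<Sum>p\<le>L. S_from d 1 (m - 1) p)
        = (\<Sum>p\<le>K. S_from d 1 (Suc m) p)"
      unfolding K
      by (simp add: sum.atMost_Suc_shift S_from_Suc_Suc sum.distrib sum_distrib_left
          del: sum.atMost_Suc)
    finally show ?thesis
      using 2 by simp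
  qed
qed

theorem theoremI:
  fixes d a :: "nat \<Rightarrow> complex" and n :: nat
  assumes "a 0 = 1"
    and "a 1 = 1"
    and "\<And>m. m \<ge> 1 \<Longrightarrow> a (m + 1) = a m + d m * a (m - 1)"
    and "n \<ge> 1"
  shows "a (n + 1) = 1 + (\<Sum>p = 1..(n + 1) div 2. S d n p)"
proof -
  have "a (n + 1) = (\<Sum>p\<le>n. S_from d 1 n p)"
    using recurrence_eq_sum_S_from [OF assms(1-3), of "n + 1" n] by simp
  \<comment> \<open>For larger \<open>p\<close>, the first index would be bounded by
    \<open>n - 2 * (p - 1) = 0\<close>, below the lower limit 1.\<close>
  also have "\<dots> = (\<Sum>p\<le>(n + 1) div 2. S_from d 1 n p)"
  proof (rule sum.mono_neutral_right)
    show "\<forall>p\<in>{..n} - {..(n + 1) div 2}. S_from d 1 n p = 0"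
    proof
      fix p assume "p \<in> {..n} - {..(n + 1) div 2}"
      then show "S_from d 1 n p = 0"
        by (cases p) (auto intro!: S_from_eq_0)
    qed
  qed (use \<open>n \<ge> 1\<close> in auto)
  also have "\<dots> = 1 + (\<Sum>p = 1..(n + 1) div 2. S d n p)"
    by (simp add: atMost_atLeast0 sum.atLeast_Suc_atMost S_eq_S_from)
  finally show ?thesis .
qed

end
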